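(* Let $\Lambda:\mathbb R\to[0,1)$ be a decreasing function, let $m\in\mathbb R$ and $v\ge0$, and let $\mathcal L(m,v)=\{X\in L^2:\ \mathbb E[X]=m,\ \mathbb E[|X-m|^2]\le v^2\}$. Then $$\sup_{X\in\mathcal L(m,v)}\mathrm{VaR}_\Lambda(X)=\sup_{X\in\mathcal L(m,v)}\mathrm{ES}_\Lambda(X)=\sup_{X\in\mathcal L(m,v)}\mathrm{EVaR}^2_\Lambda(X)=\sup_{x\in\mathbb R}\min\left\{m+v\,\Lambda(x)^{1/2}(1-\Lambda(x))^{-1/2},\ x\right\}.$$
   Context: $(\Omega,\mathcal F,\mathbb P)$ is an atomless probability space, $L^2=L^2(\Omega,\mathcal F,\mathbb P)$. "Decreasing" is meant in the weak (non-strict) sense. For $\alpha\in(0,1)$, $\mathrm{VaR}_\alpha(X)=\inf\{x:\mathbb P(X\le x)\ge\alpha\}$ and $\mathrm{ES}_\alpha(X)=\frac1{1-\alpha}\int_\alpha^1\mathrm{VaR}_s(X)\,ds$; $\mathrm{VaR}_0(X)=\operatorname{ess\,inf}(X)$, $\mathrm{ES}_0(X)=\mathbb E[X]$, $\mathrm{VaR}_1(X)=\mathrm{ES}_1(X)=\operatorname{ess\,sup}(X)$. For $X\in L^2$ and $\alpha\in[0,1)$, the Rényi entropic value-at-risk of order $2$ is $\mathrm{EVaR}^2_\alpha(X)=\sup\{\mathbb E_{\mathbb Q}[X]: \mathbb Q\ll\mathbb P \text{ a probability measure},\ H_2(d\mathbb Q/d\mathbb P)\le\log\frac1{1-\alpha}\}$,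 where $H_2(d\mathbb Q/d\mathbb P)=\log\mathbb E[(d\mathbb Q/d\mathbb P)^2]$. Lambda versions: for a family $\rho_\alpha$ equal to $\mathrm{VaR}_\alpha$, $\mathrm{ES}_\alpha$ or $\mathrm{EVaR}^2_\alpha$, $\rho_\Lambda(X)=\sup_{x\in\mathbb R}\min\{\rho_{\Lambda(x)}(X),x\}$; these are denoted $\mathrm{VaR}_\Lambda$, $\mathrm{ES}_\Lambda$, $\mathrm{EVaR}^2_\Lambda$ respectively. *)

theory Defs
  imports "HOL-Probability.Probability"
begin

definition atomless :: "'a measure \<Rightarrow> bool" where
  "atomless M \<longleftrightarrow>
     (\<forall>A\<in>sets M. 0 < emeasure M A \<longrightarrow>
        (\<exists>B\<in>sets M. B \<subseteq> A \<and> 0 < emeasure M B \<and> emeasure M B < emeasure M A))"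

text \<open>Random variables are represented by functions, not by classes modulo null sets;
  all functionals below are invariant under almost sure equality.\<close>

definition L2 :: "'a measure \<Rightarrow> ('a \<Rightarrow> real) set" where
  "L2 M = {X \<in> borel_measurable M. integrable M (\<lambda>\<omega>. (X \<omega>)\<^sup>2)}"

definition mean_variance_set :: "'a measure \<Rightarrow> real \<Rightarrow> real \<Rightarrow> ('a \<Rightarrow> real) set" where
  "mean_variance_set M m v =
     {X \<in> L2 M. (\<integral>\<omega>. X \<omega> \<partial>M) = m \<and> (\<integral>\<omega>. \<bar>X \<omega> - m\<bar>\<^sup>2 \<partial>M) \<le> v\<^sup>2}"

definition essinf :: "'a measure \<Rightarrow> ('a \<Rightarrow> real) \<Rightarrow> ereal" where
  "essinf M X = - esssup M (\<lambda>\<omega>. - ereal (X \<omega>))"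

text \<open>The risk measures take extended real values, since the essential infimum of an
  unbounded random variable may be \<open>-\<infinity>\<close> and the essential supremum may be \<open>\<infinity>\<close>.
  Only levels in \<open>[0,1]\<close> are meaningful.\<close>

definition VaR :: "'a measure \<Rightarrow> real \<Rightarrow> ('a \<Rightarrow> real) \<Rightarrow> ereal" where
  "VaR M \<alpha> X =
     (if \<alpha> = 0 then essinf M X
      else if \<alpha> = 1 then esssup M (\<lambda>\<omega>. ereal (X \<omega>))
      else Inf {ereal x |x. measure M {\<omega>\<in>space M. X \<omega> \<le> x} \<ge> \<alpha>})"

text \<open>For \<open>0 < s < 1\<close> the value \<open>VaR M s X\<close> is finite, so \<open>real_of_ereal\<close> loses nothing;
  for integrable \<open>X\<close> and \<open>0 < \<alpha> < 1\<close> the integral converges.\<close>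

definition ES :: "'a measure \<Rightarrow> real \<Rightarrow> ('a \<Rightarrow> real) \<Rightarrow> ereal" where
  "ES M \<alpha> X =
     (if \<alpha> = 0 then ereal (\<integral>\<omega>. X \<omega> \<partial>M)
      else if \<alpha> = 1 then esssup M (\<lambda>\<omega>. ereal (X \<omega>))
      else ereal (1 / (1 - \<alpha>) * (LINT s:{\<alpha><..<1}|lborel. real_of_ereal (VaR M s X))))"

text \<open>Here \<open>Y\<close> is a density. The value is \<open>\<infinity>\<close> when \<open>Y\<close> is not square integrable;
  otherwise the second moment of a probability density is at least 1, so its logarithm
  is meaningful.\<close>

definition renyi_entropy2 :: "'a measure \<Rightarrow> ('a \<Rightarrow> ennreal) \<Rightarrow> ereal" where
  "renyi_entropy2 M Y =
     (let e = (\<integral>\<^sup>+\<omega>. (Y \<omega>)\<^sup>2 \<partial>M) in if e = \<infinity> then \<infinity> else ereal (ln (enn2real e)))"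

text \<open>\<open>RN_deriv M Q\<close> is the density of \<open>Q\<close> with respect to \<open>M\<close>. If \<open>X\<close> is in \<open>L2 M\<close>, then
  finite entropy of \<open>Q\<close> makes \<open>X\<close> integrable with respect to \<open>Q\<close>.\<close>

definition EVaR2 :: "'a measure \<Rightarrow> real \<Rightarrow> ('a \<Rightarrow> real) \<Rightarrow> ereal" where
  "EVaR2 M \<alpha> X =
     Sup {ereal (\<integral>\<omega>. X \<omega> \<partial>Q) |Q.
            prob_space Q \<and> sets Q = sets M \<and> absolutely_continuous M Q \<and>
            renyi_entropy2 M (RN_deriv M Q) \<le> ereal (ln (1 / (1 - \<alpha>)))}"

definition Lambda_version ::
    "(real \<Rightarrow> ('a \<Rightarrow> real) \<Rightarrow> ereal) \<Rightarrow> (real \<Rightarrow> real) \<Rightarrow> ('a \<Rightarrow> real) \<Rightarrow> ereal" where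
  "Lambda_version \<rho> \<Lambda> X = (SUP x::real. min (\<rho> (\<Lambda> x) X) (ereal x))"

end

theory Submission
  imports Defs
begin

text \<open>All three families have the same worst case \<open>m + v * sqrt (\<alpha> / (1 - \<alpha>))\<close> at each fixed level
  \<open>\<alpha>\<close>, and since the Lambda versions are suprema over \<open>x\<close>, the two suprema can be exchanged.
  The upper bound is Cauchy-Schwarz applied to \<open>E[(X - m)(Y - 1)]\<close>, where \<open>Y\<close> is a density with
  second moment at most \<open>1 / (1 - \<alpha>)\<close>; for the expected shortfall, \<open>Y\<close> is the density of the
  uniform law on \<open>(\<alpha>, 1)\<close> and \<open>X\<close> is replaced by its quantile function on \<open>(0, 1)\<close>.
  The bound is attained or approached by variables with two values, which exist because an
  atomless space has events of every probability.\<close>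

subsection \<open>Extremal expectations under a change of measure\<close>

lemma integrable_mult_square:
  fixes f g :: "'a \<Rightarrow> real"
  assumes [measurable]: "f \<in> borel_measurable M" "g \<in> borel_measurable M"
    and "integrable M (\<lambda>x. (f x)\<^sup>2)" "integrable M (\<lambda>x. (g x)\<^sup>2)"
  shows "integrable M (\<lambda>x. f x * g x)"
proof (rule Bochner_Integration.integrable_bound)
  show "integrable M (\<lambda>x. (f x)\<^sup>2 + (g x)\<^sup>2)"
    using assms by simp
  have "\<bar>f x * g x\<bar> \<le> (f x)\<^sup>2 + (g x)\<^sup>2" for x
  proof -
    have "2 * \<bar>f x * g x\<bar> \<le> (f x)\<^sup>2 + (g x)\<^sup>2"
      using sum_squares_bound[of "\<bar>f x\<bar>" "\<bar>g x\<bar>"] by (simp add: abs_mult)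
    then show ?thesis by linarith
  qed
  then show "AE x in M. norm (f x * g x) \<le> norm ((f x)\<^sup>2 + (g x)\<^sup>2)"
    by simp
qed simp

text \<open>The integral of \<open>(f - t * g)\<^sup>2\<close> is a quadratic polynomial in
  \<open>t\<close> that is nowhere negative; the inequality says that its minimum is not
  negative.\<close>

lemma Cauchy_Schwarz_integral:
  fixes f g :: "'a \<Rightarrow> real"
  assumes [measurable]: "f \<in> borel_measurable M" "g \<in> borel_measurable M"
    and f: "integrable M (\<lambda>x. (f x)\<^sup>2)" and g: "integrable M (\<lambda>x. (g x)\<^sup>2)"
  shows "(\<integral>x. f x * g x \<partial>M)\<^sup>2 \<le> (\<integral>x. (f x)\<^sup>2 \<partial>M) * (\<integral>x. (g x)\<^sup>2 \<partial>M)"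
proof -
  let ?A = "\<integral>x. (f x)\<^sup>2 \<partial>M" and ?B = "\<integral>x. (g x)\<^sup>2 \<partial>M" and ?C = "\<integral>x. f x * g x \<partial>M"
  note fg = integrable_mult_square[OF assms]
  have quad: "0 \<le> ?A - 2 * t * ?C + t\<^sup>2 * ?B" for t
  proof -
    have "0 \<le> (\<integral>x. (f x - t * g x)\<^sup>2 \<partial>M)"
      by (rule integral_nonneg_AE) simp
    also have "\<dots> = (\<integral>x. (f x)\<^sup>2 - 2 * t * (f x * g x) + t\<^sup>2 * (g x)\<^sup>2 \<partial>M)"
      by (simp add: power2_eq_square algebra_simps)
    also have "\<dots> = ?A - 2 * t * ?C + t\<^sup>2 * ?B"
      using f g fg by simp
    finally show ?thesis .
  qed
  have "0 \<le> ?B" by (rule integral_nonneg_AE) simp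
  show ?thesis
  proof (cases "?B = 0")
    case True
    have "?C = 0"
    proof (rule ccontr)
      assume "?C \<noteq> 0"
      then show False
        \<comment> \<open>For \<open>?B = 0\<close> the polynomial is affine in \<open>t\<close>,
          and at this \<open>t\<close> its value is -1.\<close>
        using quad[of "(?A + 1) / (2 * ?C)"] True by simp
    qed
    then show ?thesis using True by simp
  next
    case False
    with \<open>0 \<le> ?B\<close> have "0 < ?B" by linarith
    \<comment> \<open>\<open>?C / ?B\<close> is the minimizer of the polynomial.\<close>
    have "?A - 2 * (?C / ?B) * ?C + (?C / ?B)\<^sup>2 * ?B = ?A - ?C\<^sup>2 / ?B"
      using False by (simp add: power2_eq_square field_simps)
    with quad[of "?C / ?B"] have "?C\<^sup>2 / ?B \<le> ?A" by simp
    then show ?thesis using \<open>0 < ?B\<close> by (simp add: field_simps)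
  qed
qed

text \<open>The excess over \<open>m\<close> is the covariance of \<open>X\<close> and
  \<open>Y\<close>, and the variance of \<open>Y\<close> is at most 1 / (1 - \<alpha>) - 1 =
  \<alpha> / (1 - \<alpha>). The bound is used on \<open>M\<close> with the density of a measure
  \<open>Q\<close>, and on the unit interval with a quantile function in place of
  \<open>X\<close>.\<close>

lemma (in prob_space) expectation_density_le:
  fixes X Y :: "'a \<Rightarrow> real"
  assumes [measurable]: "random_variable borel X" "random_variable borel Y"
    and X2: "integrable M (\<lambda>\<omega>. (X \<omega>)\<^sup>2)" and EX: "expectation X = m"
    and Var: "expectation (\<lambda>\<omega>. (X \<omega> - m)\<^sup>2) \<le> v\<^sup>2" and v: "0 \<le> v"
    and Y2: "integrable M (\<lambda>\<omega>. (Y \<omega>)\<^sup>2)" and EY: "expectation Y = 1"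
    and Y2_le: "expectation (\<lambda>\<omega>. (Y \<omega>)\<^sup>2) \<le> 1 / (1 - \<alpha>)" and \<alpha>: "0 \<le> \<alpha>" "\<alpha> < 1"
  shows "expectation (\<lambda>\<omega>. Y \<omega> * X \<omega>) \<le> m + v * sqrt (\<alpha> / (1 - \<alpha>))"
proof -
  have iX: "integrable M X" and iY: "integrable M Y"
    using X2 Y2 by (auto intro: square_integrable_imp_integrable)
  have iX2: "integrable M (\<lambda>\<omega>. (X \<omega> - m)\<^sup>2)" and iY2: "integrable M (\<lambda>\<omega>. (Y \<omega> - 1)\<^sup>2)"
    using X2 iX Y2 iY by (auto simp: power2_diff)
  have iXY: "integrable M (\<lambda>\<omega>. Y \<omega> * X \<omega>)"
    by (rule integrable_mult_square) (use X2 Y2 in auto)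
  have VarY: "expectation (\<lambda>\<omega>. (Y \<omega> - 1)\<^sup>2) \<le> \<alpha> / (1 - \<alpha>)"
    using Y2 iY EY Y2_le \<alpha> by (simp add: power2_diff prob_space field_simps)
  have "expectation (\<lambda>\<omega>. Y \<omega> * X \<omega>) - m = expectation (\<lambda>\<omega>. (X \<omega> - m) * (Y \<omega> - 1))"
  proof -
    have "expectation (\<lambda>\<omega>. (X \<omega> - m) * (Y \<omega> - 1))
      = expectation (\<lambda>\<omega>. Y \<omega> * X \<omega> - X \<omega> - m * Y \<omega> + m)"
      by (simp add: algebra_simps)
    also have "\<dots> = expectation (\<lambda>\<omega>. Y \<omega> * X \<omega>) - m"
      using iX iY iXY by (simp add: EX EY prob_space)
    finally show ?thesis by simp
  qed
  also have "\<dots> \<le> sqrt (expectation (\<lambda>\<omega>. (X \<omega> - m)\<^sup>2) * expectation (\<lambda>\<omega>. (Y \<omega> - 1)\<^sup>2))"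
    by (rule real_le_rsqrt, rule Cauchy_Schwarz_integral) (use iX2 iY2 in auto)
  also have "\<dots> \<le> sqrt (v\<^sup>2 * (\<alpha> / (1 - \<alpha>)))"
    using Var VarY by (intro real_sqrt_le_mono mult_mono) auto
  also have "\<dots> = v * sqrt (\<alpha> / (1 - \<alpha>))"
    using v by (simp only: real_sqrt_mult real_sqrt_abs abs_of_nonneg)
  finally show ?thesis by simp
qed

lemma mean_variance_setD:
  assumes "X \<in> mean_variance_set M m v"
  shows "X \<in> borel_measurable M" "integrable M (\<lambda>\<omega>. (X \<omega>)\<^sup>2)" "(\<integral>\<omega>. X \<omega> \<partial>M) = m"
    "(\<integral>\<omega>. (X \<omega> - m)\<^sup>2 \<partial>M) \<le> v\<^sup>2"
  using assms by (auto simp: mean_variance_set_def L2_def)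

text \<open>The entropy is the logarithm of the second moment of the density, so an admissible
  \<open>Q\<close> has a density to which \<open>expectation_density_le\<close> applies. Most of the
  work is the passage from the extended-valued \<open>RN_deriv\<close> to a real density.\<close>

lemma (in prob_space) EVaR2_le:
  assumes X: "X \<in> mean_variance_set M m v" and v: "0 \<le> v" and \<alpha>: "0 \<le> \<alpha>" "\<alpha> < 1"
  shows "EVaR2 M \<alpha> X \<le> ereal (m + v * sqrt (\<alpha> / (1 - \<alpha>)))"
  unfolding EVaR2_def
proof (rule Sup_least, clarify)
  fix Q assume "prob_space Q" and sets: "sets Q = sets M" and ac: "absolutely_continuous M Q"
    and H: "renyi_entropy2 M (RN_deriv M Q) \<le> ereal (ln (1 / (1 - \<alpha>)))"
  interpret Q: prob_space Q by fact
  note [measurable] = mean_variance_setD(1)[OF X]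
  define D where "D = RN_deriv M Q"
  define Y where "Y = (\<lambda>\<omega>. enn2real (D \<omega>))"
  have [measurable]: "D \<in> borel_measurable M" "Y \<in> borel_measurable M"
    by (auto simp: D_def Y_def)
  have "AE \<omega> in M. D \<omega> \<noteq> \<infinity>"
    unfolding D_def by (rule RN_deriv_finite) (use ac sets Q.sigma_finite_measure_axioms in auto)
  then have DY: "AE \<omega> in M. D \<omega> = ennreal (Y \<omega>)"
    by eventually_elim (auto simp: Y_def less_top)
  have dens: "Q = density M (\<lambda>\<omega>. ennreal (Y \<omega>))"
  proof -
    have "Q = density M D"
      unfolding D_def using ac sets by (simp add: density_RN_deriv)
    also have "\<dots> = density M (\<lambda>\<omega>. ennreal (Y \<omega>))"
      by (rule density_cong) (use DY in auto)
    finally show ?thesis .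
  qed
  define e where "e = (\<integral>\<^sup>+\<omega>. (D \<omega>)\<^sup>2 \<partial>M)"
  have fin: "e \<noteq> \<infinity>" and ln: "ln (enn2real e) \<le> ln (1 / (1 - \<alpha>))"
    using H by (auto simp: renyi_entropy2_def Let_def e_def D_def split: if_splits)
  \<comment> \<open>Logarithms can be compared only at positive arguments; the value 0 satisfies the
    bound trivially.\<close>
  have e: "enn2real e \<le> 1 / (1 - \<alpha>)"
  proof (cases "enn2real e = 0")
    case True
    then show ?thesis using \<alpha> by simp
  next
    case False
    then have "0 < enn2real e" using enn2real_nonneg[of e] by linarith
    with ln \<alpha> show ?thesis by (subst (asm) ln_le_cancel_iff) auto
  qed
  have nnY2: "(\<integral>\<^sup>+\<omega>. ennreal ((Y \<omega>)\<^sup>2) \<partial>M) = e"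
    unfolding e_def
    by (rule nn_integral_cong_AE, use DY in eventually_elim)
       (metis Y_def enn2real_nonneg ennreal_power)
  have Y2: "integrable M (\<lambda>\<omega>. (Y \<omega>)\<^sup>2)"
    by (rule integrableI_bounded) (use nnY2 fin in \<open>auto simp: less_top\<close>)
  have "expectation (\<lambda>\<omega>. (Y \<omega>)\<^sup>2) = enn2real e"
    by (subst integral_eq_nn_integral) (use nnY2 in auto)
  moreover have "expectation Y = 1"
  proof -
    \<comment> \<open>The mean of the density is the total mass of \<open>Q\<close>.\<close>
    have "1 = (\<integral>\<omega>. (1 :: real) \<partial>Q)" by (simp add: Q.prob_space)
    also have "\<dots> = expectation (\<lambda>\<omega>. Y \<omega> *\<^sub>R 1)"
      unfolding dens by (rule integral_density) (auto simp: Y_def)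
    finally show ?thesis by simp
  qed
  moreover have "(\<integral>\<omega>. X \<omega> \<partial>Q) = expectation (\<lambda>\<omega>. Y \<omega> *\<^sub>R X \<omega>)"
    unfolding dens by (rule integral_density) (auto simp: Y_def)
  ultimately show "ereal (\<integral>\<omega>. X \<omega> \<partial>Q) \<le> ereal (m + v * sqrt (\<alpha> / (1 - \<alpha>)))"
    using expectation_density_le[of X Y m v \<alpha>] mean_variance_setD[OF X] v Y2 e \<alpha> by simp
qed

subsection \<open>Quantiles\<close>

lemma VaR_eqI:
  assumes "0 < \<alpha>" "\<alpha> < 1"
    and "\<And>x. \<alpha> \<le> measure M {\<omega>\<in>space M. X \<omega> \<le> x} \<longleftrightarrow> q \<le> x"
  shows "VaR M \<alpha> X = ereal q"
proof -
  have "VaR M \<alpha> X = Inf {ereal x |x. q \<le> x}"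
    using assms by (simp add: VaR_def)
  also have "\<dots> = ereal q"
    by (rule Inf_eqI) auto
  finally show ?thesis .
qed

text \<open>At levels in (0, 1) the value-at-risk is the generalized inverse \<open>D.I\<close> of
  the distribution function, which under the uniform law has the law of \<open>X\<close>. This turns
  integrals of quantiles into expectations.\<close>

lemma (in prob_space) quantile_transform:
  assumes [measurable]: "random_variable borel X"
  obtains q :: "real \<Rightarrow> real"
  where "\<And>s. 0 < s \<Longrightarrow> s < 1 \<Longrightarrow> VaR M s X = ereal (q s)"
    and "mono_on {0<..<1} q"
    and "q \<in> borel_measurable (restrict_space lborel {0<..<1})"
    and "distr (restrict_space lborel {0<..<1}) borel q = distr M borel X"
proof -
  interpret D: cdf_distribution "distr M borel X"
    unfolding cdf_distribution_def by (rule real_distribution_distr) simp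
  have C: "D.C x = prob {\<omega>\<in>space M. X \<omega> \<le> x}" for x
    by (auto simp: cdf_def measure_distr intro!: arg_cong[where f=prob])
  show thesis
  proof (rule that)
    show "VaR M s X = ereal (D.I s)" if "0 < s" "s < 1" for s
      by (rule VaR_eqI[OF that], unfold C[symmetric], rule D.pseudoinverse[OF that])
    show "mono_on {0<..<1} D.I" by (rule D.mono_I)
    show "D.I \<in> borel_measurable (restrict_space lborel {0<..<1})"
      using D.measurable_CI measurable_cong_sets[OF sets_restrict_space_cong[OF sets_lborel] refl]
      by blast
    show "distr (restrict_space lborel {0<..<1}) borel D.I = distr M borel X"
      by (rule D.distr_I_eq_M)
  qed
qed

lemma prob_space_unit_interval: "prob_space (restrict_space lborel {0<..<1::real})"
  by (auto simp: space_restrict_space emeasure_restrict_space intro!: prob_spaceI)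

text \<open>Translates the set integral in \<open>ES\<close> into an expectation on the unit
  interval; 0 \<le> \<alpha> puts the range of integration inside (0, 1).\<close>

lemma integral_unit_interval_indicator:
  fixes f :: "real \<Rightarrow> real"
  assumes "0 \<le> \<alpha>"
  shows "(\<integral>s. indicator {\<alpha><..<1} s * f s \<partial>restrict_space lborel {0<..<1})
    = (LINT s:{\<alpha><..<1}|lborel. f s)"
proof -
  have "(\<integral>s. indicator {\<alpha><..<1} s * f s \<partial>restrict_space lborel {0<..<1})
    = (\<integral>s. indicator {0<..<1} s *\<^sub>R (indicator {\<alpha><..<1} s * f s) \<partial>lborel)"
    by (rule integral_restrict_space) simp
  also have "\<dots> = (LINT s:{\<alpha><..<1}|lborel. f s)"
    unfolding set_lebesgue_integral_def using assms
    by (intro Bochner_Integration.integral_cong) (auto simp: indicator_def)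
  finally show ?thesis .
qed

text \<open>For \<alpha> > 0 the expected shortfall is the mean of \<open>Y * q\<close>, with
  \<open>q\<close> the quantile function and \<open>Y\<close> the uniform density on (\<alpha>, 1).
  The upper bound is \<open>expectation_density_le\<close>; the lower one holds because
  \<open>q\<close> is increasing. At \<alpha> = 0 the essential infimum is compared with the
  mean.\<close>

lemma (in prob_space) VaR_ES_le:
  assumes X: "X \<in> mean_variance_set M m v" and v: "0 \<le> v" and \<alpha>: "0 \<le> \<alpha>" "\<alpha> < 1"
  shows "VaR M \<alpha> X \<le> ES M \<alpha> X" and "ES M \<alpha> X \<le> ereal (m + v * sqrt (\<alpha> / (1 - \<alpha>)))"
proof -
  note [measurable] = mean_variance_setD(1)[OF X]
  have iX: "integrable M X"
    using mean_variance_setD(2)[OF X] by (auto intro: square_integrable_imp_integrable)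
  have "VaR M \<alpha> X \<le> ES M \<alpha> X \<and> ES M \<alpha> X \<le> ereal (m + v * sqrt (\<alpha> / (1 - \<alpha>)))"
  proof (cases "\<alpha> = 0")
    case True
    have AE: "AE \<omega> in M. essinf M X \<le> ereal (X \<omega>)"
      using esssup_AE[of "\<lambda>\<omega>. - ereal (X \<omega>)" M]
      by eventually_elim (simp add: essinf_def ereal_uminus_le_reorder)
    have "essinf M X \<le> ereal (expectation X)"
    proof (cases "essinf M X")
      case (real r)
      with AE have "AE \<omega> in M. r \<le> X \<omega>" by simp
      then have "expectation (\<lambda>_. r) \<le> expectation X"
        using iX by (intro integral_mono_AE) auto
      then show ?thesis using real by (simp add: prob_space)
    next
      \<comment> \<open>An infinite essential infimum would force the real-valued \<open>X\<close>
        to be infinite almost surely.\<close>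
      case PInf
      with AE have "AE \<omega> in M. False" by simp
      then show ?thesis by simp
    qed simp
    then show ?thesis
      using True mean_variance_setD(3)[OF X] by (simp add: VaR_def ES_def)
  next
    case False
    with \<alpha> have \<alpha>: "0 < \<alpha>" "\<alpha> < 1" by auto
    obtain q where q: "\<And>s. 0 < s \<Longrightarrow> s < 1 \<Longrightarrow> VaR M s X = ereal (q s)"
      and mono: "mono_on {0<..<1} q"
      and meas: "q \<in> borel_measurable (restrict_space lborel {0<..<1})"
      and distr: "distr (restrict_space lborel {0<..<1}) borel q = distr M borel X"
      by (rule quantile_transform[of X]) auto
    define U where "U = restrict_space lborel {0<..<1::real}"
    interpret U: prob_space U
      unfolding U_def by (rule prob_space_unit_interval)
    have [measurable]: "q \<in> borel_measurable U" using meas by (simp add: U_def)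
    \<comment> \<open>Equality in law carries the mean, the variance and square integrability from
      \<open>X\<close> to \<open>q\<close>.\<close>
    have law: "(\<integral>s. f (q s) \<partial>U) = expectation (\<lambda>\<omega>. f (X \<omega>))"
      and law_i: "integrable U (\<lambda>s. f (q s)) \<longleftrightarrow> integrable M (\<lambda>\<omega>. f (X \<omega>))"
      if [measurable]: "f \<in> borel_measurable borel" for f :: "real \<Rightarrow> real"
      using integral_distr[of q U borel f] integral_distr[of X M borel f]
        integrable_distr_eq[of q U borel f] integrable_distr_eq[of X M borel f] distr
      by (auto simp: U_def[symmetric])
    define Y where "Y s = indicator {\<alpha><..<1} s / (1 - \<alpha>)" for s :: real
    have [measurable]: "Y \<in> borel_measurable U"
      unfolding Y_def U_def by (intro measurable_restrict_space1) measurable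
    have int_ind: "(\<integral>s. indicator {\<alpha><..<1} s \<partial>U) = 1 - \<alpha>"
      using integral_unit_interval_indicator[of \<alpha> "\<lambda>_. 1"] \<alpha>
      by (simp add: U_def set_lebesgue_integral_def)
    have EY: "U.expectation Y = 1"
      unfolding Y_def using int_ind \<alpha> by (simp del: integral_indicator)
    \<comment> \<open>Since an indicator is its own square, the second moment of \<open>Y\<close> is
      exactly 1 / (1 - \<alpha>).\<close>
    have Y_sq: "(Y s)\<^sup>2 = Y s / (1 - \<alpha>)" for s
      by (simp add: Y_def power2_eq_square indicator_def)
    have iY: "integrable U Y"
      by (rule U.integrable_const_bound[of _ "1 / (1 - \<alpha>)"])
         (use \<alpha> in \<open>auto simp: Y_def indicator_def\<close>)
    have ES: "ES M \<alpha> X = ereal (U.expectation (\<lambda>s. Y s * q s))"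
    proof -
      have "U.expectation (\<lambda>s. Y s * q s)
        = 1 / (1 - \<alpha>) * (LINT s:{\<alpha><..<1}|lborel. q s)"
        using integral_unit_interval_indicator[of \<alpha> q] \<alpha> by (simp add: Y_def U_def)
      also have "(LINT s:{\<alpha><..<1}|lborel. q s)
        = (LINT s:{\<alpha><..<1}|lborel. real_of_ereal (VaR M s X))"
        using q \<alpha> by (intro set_lebesgue_integral_cong) auto
      finally show ?thesis using \<alpha> by (simp add: ES_def)
    qed
    have q2: "integrable U (\<lambda>s. (q s)\<^sup>2)"
      using law_i[of "\<lambda>x. x\<^sup>2"] mean_variance_setD(2)[OF X] by simp
    have upper: "U.expectation (\<lambda>s. Y s * q s) \<le> m + v * sqrt (\<alpha> / (1 - \<alpha>))"
    proof (rule U.expectation_density_le)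
      show "U.expectation q = m"
        using law[of "\<lambda>x. x"] mean_variance_setD(3)[OF X] by simp
      show "U.expectation (\<lambda>s. (q s - m)\<^sup>2) \<le> v\<^sup>2"
        using law[of "\<lambda>x. (x - m)\<^sup>2"] mean_variance_setD(4)[OF X] by simp
      show "U.expectation (\<lambda>s. (Y s)\<^sup>2) \<le> 1 / (1 - \<alpha>)"
        using EY by (simp add: Y_sq)
      show "integrable U (\<lambda>s. (Y s)\<^sup>2)"
        using iY by (simp add: Y_sq)
    qed (use q2 EY v \<alpha> in auto)
    have "q \<alpha> = U.expectation (\<lambda>s. Y s * q \<alpha>)"
      using EY by simp
    also have "\<dots> \<le> U.expectation (\<lambda>s. Y s * q s)"
    proof (rule integral_mono)
      show "integrable U (\<lambda>s. Y s * q \<alpha>)" using iY by simp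
      show "integrable U (\<lambda>s. Y s * q s)"
        by (rule integrable_mult_square) (use iY q2 in \<open>auto simp: Y_sq\<close>)
      show "Y s * q \<alpha> \<le> Y s * q s" for s
        using mono_onD[OF mono, of \<alpha> s] \<alpha>
        by (auto simp: Y_def indicator_def divide_right_mono)
    qed
    finally show ?thesis
      using ES upper q[of \<alpha>] \<alpha> by simp
  qed
  then show "VaR M \<alpha> X \<le> ES M \<alpha> X" "ES M \<alpha> X \<le> ereal (m + v * sqrt (\<alpha> / (1 - \<alpha>)))"
    by auto
qed

subsection \<open>Two-point distributions\<close>

text \<open>A proper split of an event leaves a part with at most half of its probability, and
  halving can be repeated.\<close>

lemma (in prob_space) atomless_small_subset:
  assumes at: "atomless M" and A: "A \<in> events" "0 < prob A" and "0 < \<epsilon>"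
  obtains B where "B \<in> events" "B \<subseteq> A" "0 < prob B" "prob B < \<epsilon>"
proof -
  have halve: "\<exists>B\<in>events. B \<subseteq> A \<and> 0 < prob B \<and> prob B \<le> prob A / 2"
    if A: "A \<in> events" "0 < prob A" for A
  proof -
    have "0 < emeasure M A" using A by (simp add: emeasure_eq_measure)
    with at A obtain B where B: "B \<in> events" "B \<subseteq> A" "0 < prob B" "prob B < prob A"
      unfolding atomless_def by (fastforce simp: emeasure_eq_measure ennreal_less_iff)
    have D: "prob (A - B) = prob A - prob B"
      using A B by (intro finite_measure_Diff) auto
    show ?thesis
    proof (cases "prob B \<le> prob A / 2")
      case True
      with B show ?thesis by auto
    next
      case False
      with A B D show ?thesis by (intro bexI[of _ "A - B"]) auto
    qed
  qed
  have "\<exists>B\<in>events. B \<subseteq> A \<and> 0 < prob B \<and> prob B \<le> prob A / 2 ^ n" for n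
  proof (induction n)
    case 0
    show ?case using A by auto
  next
    case (Suc n)
    then obtain B where B: "B \<in> events" "B \<subseteq> A" "0 < prob B" "prob B \<le> prob A / 2 ^ n"
      by auto
    obtain C where C: "C \<in> events" "C \<subseteq> B" "0 < prob C" "prob C \<le> prob B / 2"
      using halve[OF B(1,3)] by auto
    have "prob C \<le> prob A / 2 ^ Suc n"
      using B(4) C(4) divide_right_mono[OF B(4), of 2] by simp
    with B C show ?case by blast
  qed
  moreover obtain n where "prob A / \<epsilon> < 2 ^ n"
    using real_arch_pow[of 2 "prob A / \<epsilon>"] by auto
  then have "prob A / 2 ^ n < \<epsilon>"
    using \<open>0 < \<epsilon>\<close> by (simp add: field_simps)
  ultimately obtain B where "B \<in> events" "B \<subseteq> A" "0 < prob B" "prob B < \<epsilon>"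
    by (meson le_less_trans)
  then show thesis by (rule that)
qed

text \<open>Sierpinski's theorem. Each set of the chain realizes at least half of the increase that
  is still possible below \<open>t\<close>, so a gap left by the union could be narrowed by more than
  the chain ever gains.\<close>

lemma (in prob_space) atomless_obtain_prob:
  assumes at: "atomless M" and t: "0 \<le> t" "t \<le> 1"
  obtains A where "A \<in> events" "prob A = t"
proof -
  define P where "P A \<longleftrightarrow> A \<in> events \<and> prob A \<le> t" for A
  \<comment> \<open>The inequality says that \<open>prob C - prob A\<close> is at most twice
    \<open>prob B - prob A\<close>. Quantifying over \<open>C\<close> keeps the supremum out of the
    relation.\<close>
  define R where "R A B \<longleftrightarrow> A \<subseteq> B \<and> (\<forall>C. P C \<and> A \<subseteq> C \<longrightarrow> prob A + prob C \<le> 2 * prob B)" for A B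
  have step: "\<exists>B. P B \<and> R A B" if A: "P A" for A
  proof -
    define s where "s = (SUP C\<in>{C. P C \<and> A \<subseteq> C}. prob C)"
    have bdd: "bdd_above (prob ` {C. P C \<and> A \<subseteq> C})"
      by (rule bdd_aboveI2[of _ _ t]) (auto simp: P_def)
    have s: "prob C \<le> s" if "P C" "A \<subseteq> C" for C
      unfolding s_def by (rule cSUP_upper) (use that bdd in auto)
    have "\<exists>B. P B \<and> A \<subseteq> B \<and> prob A + s \<le> 2 * prob B"
    proof (cases "s \<le> prob A")
      case True
      with A show ?thesis by auto
    next
      case False
      \<comment> \<open>The midpoint lies strictly below the supremum, so some admissible
        \<open>C\<close> exceeds it.\<close>
      then have "(prob A + s) / 2 < s" by simp
      then have "\<exists>C\<in>{C. P C \<and> A \<subseteq> C}. (prob A + s) / 2 < prob C"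
        using A less_cSUP_iff[OF _ bdd, of "(prob A + s) / 2"] by (auto simp: s_def)
      then obtain C where "P C" "A \<subseteq> C" "(prob A + s) / 2 < prob C" by auto
      then show ?thesis by (intro exI[of _ C]) auto
    qed
    with s show ?thesis
      unfolding R_def by (meson add_left_mono order_trans)
  qed
  have "\<exists>A. \<forall>n. P (A n) \<and> R (A n) (A (Suc n))"
    by (rule dependent_nat_choice) (use step t in \<open>auto simp: P_def intro: exI[of _ "{}"]\<close>)
  then obtain A where A: "\<And>n. P (A n)" "\<And>n. R (A n) (A (Suc n))" by blast
  define L where "L = (\<Union>n. A n)"
  have ev: "range A \<subseteq> events" using A by (auto simp: P_def)
  then have L: "L \<in> events" unfolding L_def by auto
  have lim: "(\<lambda>n. prob (A n)) \<longlonglongrightarrow> prob L"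
    unfolding L_def using A ev by (intro finite_Lim_measure_incseq incseq_SucI) (auto simp: R_def)
  have "prob L \<le> t"
    by (rule LIMSEQ_le_const2[OF lim]) (use A in \<open>auto simp: P_def\<close>)
  moreover have "\<not> prob L < t"
  proof
    assume less: "prob L < t"
    have "prob (space M - L) = 1 - prob L" by (rule prob_compl[OF L])
    with less t L obtain B where B: "B \<in> events" "B \<subseteq> space M - L" "0 < prob B" "prob B < t - prob L"
      using atomless_small_subset[OF at, of "space M - L" "t - prob L"] by auto
    have un: "prob (L \<union> B) = prob L + prob B"
      using B L by (intro finite_measure_Union) auto
    \<comment> \<open>\<open>L \<union> B\<close> competes at every stage: it contains each
      \<open>A n\<close> and its probability stays below \<open>t\<close>. In the limit this forces
      \<open>prob B\<close> to be at most 0.\<close>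
    have "prob (A n) + prob (L \<union> B) \<le> 2 * prob (A (Suc n))" for n
    proof -
      have "P (L \<union> B)" "A n \<subseteq> L \<union> B"
        using B L un by (auto simp: P_def L_def)
      then show ?thesis using A(2)[of n] by (simp add: R_def)
    qed
    moreover have "(\<lambda>n. prob (A n) + prob (L \<union> B)) \<longlonglongrightarrow> prob L + prob (L \<union> B)"
      by (intro tendsto_intros lim)
    moreover have "(\<lambda>n. 2 * prob (A (Suc n))) \<longlonglongrightarrow> 2 * prob L"
      by (intro tendsto_intros LIMSEQ_Suc lim)
    ultimately have "prob L + prob (L \<union> B) \<le> 2 * prob L"
      by (meson LIMSEQ_le)
    with un B show False by simp
  qed
  ultimately show thesis using L that by (meson not_less order_antisym)
qed

text \<open>At \<open>\<beta> = 0\<close> the second value is \<open>m\<close>, since \<open>1 / 0 = 0\<close>; the event \<open>A\<close> then has full measure.\<close>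

definition two_point :: "'a set \<Rightarrow> real \<Rightarrow> real \<Rightarrow> real \<Rightarrow> 'a \<Rightarrow> real" where
  "two_point A \<beta> m v \<omega> =
     (if \<omega> \<in> A then m + v * sqrt (\<beta> / (1 - \<beta>)) else m - v * sqrt ((1 - \<beta>) / \<beta>))"

lemma two_point_le:
  assumes "0 \<le> v" "0 \<le> \<beta>" "\<beta> < 1"
  shows "two_point A \<beta> m v \<omega> \<le> m + v * sqrt (\<beta> / (1 - \<beta>))"
proof -
  have "0 \<le> v * sqrt (\<beta> / (1 - \<beta>))" "0 \<le> v * sqrt ((1 - \<beta>) / \<beta>)"
    using assms by simp_all
  then show ?thesis by (simp add: two_point_def)
qed

text \<open>The standardized values \<open>h\<close> and \<open>l\<close> have probabilities 1 -
  \<beta> and \<beta>. Their contributions to the mean cancel, and those to the second moment are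
  \<beta> and 1 - \<beta> when \<beta> > 0.\<close>

lemma (in prob_space) two_point_mean_variance:
  assumes A [measurable]: "A \<in> events" and pA: "prob A = 1 - \<beta>" and \<beta>: "0 \<le> \<beta>" "\<beta> < 1"
  shows "two_point A \<beta> m v \<in> mean_variance_set M m v"
proof -
  define h l where "h = sqrt (\<beta> / (1 - \<beta>))" and "l = - sqrt ((1 - \<beta>) / \<beta>)"
  \<comment> \<open>Any function of a two-valued variable is affine in the indicator of
    \<open>A\<close>, so one formula yields all moments.\<close>
  have eq: "f (two_point A \<beta> m v \<omega>) = f (m + v * l) + (f (m + v * h) - f (m + v * l)) * indicator A \<omega>"
    for f :: "real \<Rightarrow> real" and \<omega>
    by (simp add: two_point_def h_def l_def indicator_def)
  have int: "integrable M (\<lambda>\<omega>. f (two_point A \<beta> m v \<omega>))"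
    and exp: "expectation (\<lambda>\<omega>. f (two_point A \<beta> m v \<omega>)) = f (m + v * h) * (1 - \<beta>) + f (m + v * l) * \<beta>"
    for f :: "real \<Rightarrow> real"
    unfolding eq[of f] by (simp_all add: prob_space pA algebra_simps emeasure_eq_measure)
  have hl: "h * (1 - \<beta>) + l * \<beta> = 0" "h\<^sup>2 * (1 - \<beta>) + l\<^sup>2 * \<beta> \<le> 1"
  proof -
    have "h * (1 - \<beta>) = sqrt \<beta> * sqrt (1 - \<beta>)"
      using \<beta> real_div_sqrt[of "1 - \<beta>"] by (simp add: h_def real_sqrt_divide field_simps)
    moreover have "l * \<beta> = - (sqrt \<beta> * sqrt (1 - \<beta>))"
      using \<beta> real_div_sqrt[of \<beta>] by (cases "\<beta> = 0") (simp_all add: l_def real_sqrt_divide field_simps)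
    ultimately show "h * (1 - \<beta>) + l * \<beta> = 0" by simp
    \<comment> \<open>The left side is 1 for \<beta> > 0 but 0 for \<beta> = 0, hence an
      inequality.\<close>
    show "h\<^sup>2 * (1 - \<beta>) + l\<^sup>2 * \<beta> \<le> 1"
      using \<beta> by (cases "\<beta> = 0") (simp_all add: h_def l_def)
  qed
  have "expectation (two_point A \<beta> m v) = m"
  proof -
    have "expectation (two_point A \<beta> m v) = m + v * (h * (1 - \<beta>) + l * \<beta>)"
      using exp[of "\<lambda>x. x"] by (simp add: algebra_simps)
    then show ?thesis by (simp add: hl)
  qed
  moreover have "expectation (\<lambda>\<omega>. \<bar>two_point A \<beta> m v \<omega> - m\<bar>\<^sup>2) \<le> v\<^sup>2"
  proof -
    have "expectation (\<lambda>\<omega>. \<bar>two_point A \<beta> m v \<omega> - m\<bar>\<^sup>2) = v\<^sup>2 * (h\<^sup>2 * (1 - \<beta>) + l\<^sup>2 * \<beta>)"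
      using exp[of "\<lambda>x. \<bar>x - m\<bar>\<^sup>2"] by (simp add: power_mult_distrib algebra_simps)
    also have "\<dots> \<le> v\<^sup>2 * 1" by (intro mult_left_mono hl) simp
    finally show ?thesis by simp
  qed
  ultimately show ?thesis
    using int[of "\<lambda>x. x\<^sup>2"] borel_measurable_integrable[OF int[of "\<lambda>x. x"]]
    by (simp add: mean_variance_set_def L2_def)
qed

text \<open>Below the upper value lies only the complement of \<open>A\<close>, whose probability
  \<beta> falls strictly short of \<alpha>.\<close>

lemma (in prob_space) VaR_two_point:
  assumes A: "A \<in> events" and pA: "prob A = 1 - \<beta>" and \<beta>: "0 \<le> \<beta>" "\<beta> < \<alpha>" "\<alpha> < 1" and v: "0 \<le> v"
  shows "VaR M \<alpha> (two_point A \<beta> m v) = ereal (m + v * sqrt (\<beta> / (1 - \<beta>)))"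
proof (rule VaR_eqI)
  let ?X = "two_point A \<beta> m v" and ?h = "m + v * sqrt (\<beta> / (1 - \<beta>))"
  fix x
  show "\<alpha> \<le> prob {\<omega>\<in>space M. ?X \<omega> \<le> x} \<longleftrightarrow> ?h \<le> x"
  proof
    assume "?h \<le> x"
    then have "{\<omega>\<in>space M. ?X \<omega> \<le> x} = space M"
      using two_point_le[OF v \<beta>(1), of A m] \<beta> by (auto intro: order_trans)
    then show "\<alpha> \<le> prob {\<omega>\<in>space M. ?X \<omega> \<le> x}"
      using \<beta> by (simp add: prob_space)
  next
    assume *: "\<alpha> \<le> prob {\<omega>\<in>space M. ?X \<omega> \<le> x}"
    show "?h \<le> x"
    proof (rule ccontr)
      assume "\<not> ?h \<le> x"
      then have "{\<omega>\<in>space M. ?X \<omega> \<le> x} \<subseteq> space M - A"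
        by (auto simp: two_point_def)
      then have "prob {\<omega>\<in>space M. ?X \<omega> \<le> x} \<le> prob (space M - A)"
        using A by (intro finite_measure_mono) auto
      with * \<beta> pA prob_compl[OF A] show False by simp
    qed
  qed
qed (use \<beta> in auto)

text \<open>All quantiles at levels strictly above \<alpha> equal the upper value, and the average
  does not see the level \<alpha> itself. At \<alpha> = 0 both sides reduce to the mean
  \<open>m\<close>.\<close>

lemma (in prob_space) ES_two_point:
  assumes A [measurable]: "A \<in> events" and pA: "prob A = 1 - \<alpha>" and \<alpha>: "0 \<le> \<alpha>" "\<alpha> < 1" and v: "0 \<le> v"
  shows "ES M \<alpha> (two_point A \<alpha> m v) = ereal (m + v * sqrt (\<alpha> / (1 - \<alpha>)))"
proof (cases "\<alpha> = 0")
  case True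
  then show ?thesis
    using mean_variance_setD(3)[OF two_point_mean_variance[OF assms(1-4)]] by (simp add: ES_def)
next
  case False
  let ?h = "m + v * sqrt (\<alpha> / (1 - \<alpha>))"
  have "(LINT s:{\<alpha><..<1}|lborel. real_of_ereal (VaR M s (two_point A \<alpha> m v)))
    = (LINT s:{\<alpha><..<1}|lborel. ?h)"
    using VaR_two_point[OF A pA \<alpha>(1) _ _ v] by (intro set_lebesgue_integral_cong) auto
  also have "\<dots> = (1 - \<alpha>) * ?h"
    using \<alpha> by (simp add: set_lebesgue_integral_def)
  finally show ?thesis
    using False \<alpha> by (simp add: ES_def)
qed

text \<open>The witness \<open>Q\<close> is the conditional probability given \<open>A\<close>. Its
  density has second moment (1 - \<alpha>) / (1 - \<alpha>)^2, exactly the admissible maximum, and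
  under \<open>Q\<close> the variable is almost surely its upper value.\<close>

lemma (in prob_space) EVaR2_two_point:
  assumes A [measurable]: "A \<in> events" and pA: "prob A = 1 - \<alpha>" and \<alpha>: "0 \<le> \<alpha>" "\<alpha> < 1"
  shows "ereal (m + v * sqrt (\<alpha> / (1 - \<alpha>))) \<le> EVaR2 M \<alpha> (two_point A \<alpha> m v)"
  unfolding EVaR2_def
proof (rule Sup_upper, rule CollectI, intro exI conjI)
  define Y where "Y \<omega> = indicator A \<omega> / (1 - \<alpha>)" for \<omega>
  define Q where "Q = density M (\<lambda>\<omega>. ennreal (Y \<omega>))"
  have [measurable]: "Y \<in> borel_measurable M" unfolding Y_def by measurable
  have Y_ind: "ennreal (Y \<omega>) = ennreal (1 / (1 - \<alpha>)) * indicator A \<omega>" 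
    and Y2_ind: "ennreal (Y \<omega>)^2 = ennreal (1 / (1 - \<alpha>)^2) * indicator A \<omega>" for \<omega>
    using \<alpha> by (simp_all add: Y_def indicator_def ennreal_power power_divide)
  have EY: "(\<integral>\<^sup>+\<omega>. ennreal (Y \<omega>) \<partial>M) = 1"
    unfolding Y_ind using \<alpha> by (simp add: nn_integral_cmult emeasure_eq_measure pA flip: ennreal_mult)
  show "prob_space Q"
    by (rule prob_spaceI) (simp add: Q_def emeasure_density EY cong: nn_integral_cong)
  show "sets Q = sets M" by (simp add: Q_def)
  show "absolutely_continuous M Q"
    unfolding Q_def by (rule absolutely_continuousI_density) simp
  \<comment> \<open>\<open>RN_deriv\<close> is determined only up to null sets, which suffices for
    its second moment.\<close>
  have "AE \<omega> in M. ennreal (Y \<omega>) = RN_deriv M Q \<omega>"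
    by (rule RN_deriv_unique) (auto simp: Q_def)
  then have "(\<integral>\<^sup>+\<omega>. (RN_deriv M Q \<omega>)\<^sup>2 \<partial>M) = (\<integral>\<^sup>+\<omega>. (ennreal (Y \<omega>))\<^sup>2 \<partial>M)"
    by (intro nn_integral_cong_AE) auto
  also have "\<dots> = ennreal (1 / (1 - \<alpha>))"
    unfolding Y2_ind using \<alpha>
    by (simp add: nn_integral_cmult emeasure_eq_measure pA power2_eq_square flip: ennreal_mult)
  finally show "renyi_entropy2 M (RN_deriv M Q) \<le> ereal (ln (1 / (1 - \<alpha>)))"
    using \<alpha> by (simp add: renyi_entropy2_def)
  have "(\<integral>\<omega>. two_point A \<alpha> m v \<omega> \<partial>Q) = expectation (\<lambda>\<omega>. Y \<omega> *\<^sub>R two_point A \<alpha> m v \<omega>)"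
    unfolding Q_def using \<alpha> mean_variance_setD(1)[OF two_point_mean_variance[OF assms]]
    by (intro integral_density) (auto simp: Y_def)
  also have "\<dots> = expectation (\<lambda>\<omega>. (m + v * sqrt (\<alpha> / (1 - \<alpha>))) / (1 - \<alpha>) * indicator A \<omega>)"
    by (intro Bochner_Integration.integral_cong) (auto simp: Y_def two_point_def indicator_def)
  also have "\<dots> = m + v * sqrt (\<alpha> / (1 - \<alpha>))"
    using \<alpha> by (simp add: pA)
  finally show "ereal (m + v * sqrt (\<alpha> / (1 - \<alpha>))) = ereal (\<integral>\<omega>. two_point A \<alpha> m v \<omega> \<partial>Q)"
    by simp
qed

subsection \<open>Worst cases over the mean-variance set\<close>

context prob_space
begin

context
  fixes m v \<alpha> :: real
  assumes atomless: "atomless M" and v: "0 \<le> v" and \<alpha>: "0 \<le> \<alpha>" "\<alpha> < 1"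
begin

text \<open>The level \<beta> is kept apart from \<alpha> because the value-at-risk is approached
  through levels below \<alpha>.\<close>

lemma obtain_extremal_event:
  assumes "0 \<le> \<beta>" "\<beta> < 1"
  obtains A where "A \<in> events" "prob A = 1 - \<beta>" "two_point A \<beta> m v \<in> mean_variance_set M m v"
proof -
  obtain A where "A \<in> events" "prob A = 1 - \<beta>"
    using atomless_obtain_prob[OF atomless, of "1 - \<beta>"] assms by auto
  with that two_point_mean_variance assms show thesis by blast
qed

lemma SUP_EVaR2:
  "(SUP X\<in>mean_variance_set M m v. EVaR2 M \<alpha> X) = ereal (m + v * sqrt (\<alpha> / (1 - \<alpha>)))"
proof (rule antisym)
  show "(SUP X\<in>mean_variance_set M m v. EVaR2 M \<alpha> X) \<le> ereal (m + v * sqrt (\<alpha> / (1 - \<alpha>)))"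
    by (rule SUP_least) (rule EVaR2_le[OF _ v \<alpha>])
  obtain A where "A \<in> events" "prob A = 1 - \<alpha>" "two_point A \<alpha> m v \<in> mean_variance_set M m v"
    by (rule obtain_extremal_event[OF \<alpha>])
  then show "ereal (m + v * sqrt (\<alpha> / (1 - \<alpha>))) \<le> (SUP X\<in>mean_variance_set M m v. EVaR2 M \<alpha> X)"
    using \<alpha> by (intro SUP_upper2[of "two_point A \<alpha> m v"] EVaR2_two_point) auto
qed

lemma SUP_ES:
  "(SUP X\<in>mean_variance_set M m v. ES M \<alpha> X) = ereal (m + v * sqrt (\<alpha> / (1 - \<alpha>)))"
proof (rule antisym)
  show "(SUP X\<in>mean_variance_set M m v. ES M \<alpha> X) \<le> ereal (m + v * sqrt (\<alpha> / (1 - \<alpha>)))"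
    by (rule SUP_least) (rule VaR_ES_le(2)[OF _ v \<alpha>])
  obtain A where "A \<in> events" "prob A = 1 - \<alpha>" "two_point A \<alpha> m v \<in> mean_variance_set M m v"
    by (rule obtain_extremal_event[OF \<alpha>])
  then show "ereal (m + v * sqrt (\<alpha> / (1 - \<alpha>))) \<le> (SUP X\<in>mean_variance_set M m v. ES M \<alpha> X)"
    using \<alpha> v by (intro SUP_upper2[of "two_point A \<alpha> m v"]) (auto simp: ES_two_point)
qed

text \<open>For \<open>\<alpha> > 0\<close> the supremum of the value-at-risk need not be attained: the two-point variable
  of level \<open>\<alpha>\<close> has its lower value as \<open>\<alpha>\<close>-quantile, so levels \<open>\<beta> < \<alpha>\<close> approach the bound instead.\<close>

lemma SUP_VaR:
  "(SUP X\<in>mean_variance_set M m v. VaR M \<alpha> X) = ereal (m + v * sqrt (\<alpha> / (1 - \<alpha>)))"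
proof (rule antisym)
  let ?S = "SUP X\<in>mean_variance_set M m v. VaR M \<alpha> X"
  show "?S \<le> ereal (m + v * sqrt (\<alpha> / (1 - \<alpha>)))"
    by (rule SUP_least) (rule order_trans[OF VaR_ES_le[OF _ v \<alpha>]])
  show "ereal (m + v * sqrt (\<alpha> / (1 - \<alpha>))) \<le> ?S"
  proof (cases "\<alpha> = 0")
    case True
    \<comment> \<open>At \<alpha> = 0 no smaller level is available, but the bound is
      \<open>m\<close> and a constant attains it.\<close>
    have "(\<lambda>_. m) \<in> mean_variance_set M m v"
      by (simp add: mean_variance_set_def L2_def prob_space)
    moreover have "VaR M \<alpha> (\<lambda>_. m) = ereal m"
      using esssup_const[of M "- ereal m"] True
      by (simp add: VaR_def essinf_def emeasure_space_1)
    ultimately show ?thesis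
      using True by (intro SUP_upper2[of "\<lambda>_. m"]) auto
  next
    case False
    with \<alpha> have "0 < \<alpha>" by simp
    have le: "ereal (m + v * sqrt (\<beta> / (1 - \<beta>))) \<le> ?S" if "0 < \<beta>" "\<beta> < \<alpha>" for \<beta>
    proof -
      obtain A where "A \<in> events" "prob A = 1 - \<beta>" "two_point A \<beta> m v \<in> mean_variance_set M m v"
        by (rule obtain_extremal_event[of \<beta>]) (use \<open>0 < \<beta>\<close> \<open>\<beta> < \<alpha>\<close> \<alpha> in auto)
      then show ?thesis
        using that \<alpha> v by (intro SUP_upper2[of "two_point A \<beta> m v"]) (auto simp: VaR_two_point)
    qed
    show ?thesis
    proof (rule tendsto_upperbound)
      \<comment> \<open>The bound is continuous in the level, as \<alpha> < 1 keeps the denominator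
        away from 0.\<close>
      show "((\<lambda>\<beta>. ereal (m + v * sqrt (\<beta> / (1 - \<beta>)))) \<longlongrightarrow> ereal (m + v * sqrt (\<alpha> / (1 - \<alpha>)))) (at_left \<alpha>)"
        using \<alpha> by (intro tendsto_intros) auto
      show "\<forall>\<^sub>F \<beta> in at_left \<alpha>. ereal (m + v * sqrt (\<beta> / (1 - \<beta>))) \<le> ?S"
        unfolding eventually_at_left[OF \<open>0 < \<alpha>\<close>] using \<open>0 < \<alpha>\<close> le by auto
    qed simp
  qed
qed

end

end

section \<open>From fixed levels to the Lambda versions\<close>

text \<open>The suprema over \<open>X\<close> and \<open>x\<close> commute, and the minimum with a
  fixed \<open>x\<close> distributes over the supremum over \<open>X\<close>. Writing
  \<open>min\<close> as \<open>inf\<close> gives access to the lattice law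
  \<open>SUP_inf\<close>.\<close>

lemma SUP_Lambda_version:
  assumes "\<And>x. (SUP X\<in>S. \<rho> (\<Lambda> x) X) = ereal (b x)"
  shows "(SUP X\<in>S. Lambda_version \<rho> \<Lambda> X) = (SUP x. ereal (min (b x) x))"
proof -
  have "(SUP X\<in>S. Lambda_version \<rho> \<Lambda> X) = (SUP x. SUP X\<in>S. inf (\<rho> (\<Lambda> x) X) (ereal x))"
    unfolding Lambda_version_def inf_min by (rule SUP_commute)
  also have "\<dots> = (SUP x. inf (ereal (b x)) (ereal x))"
    by (simp only: assms flip: SUP_inf)
  finally show ?thesis by (simp add: inf_min ereal_min)
qed

theorem proposition4p5:
  fixes M :: "'a measure" and \<Lambda> :: "real \<Rightarrow> real" and m v :: real
  assumes "prob_space M" and "atomless M"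
    and "antimono \<Lambda>" and "\<And>x. \<Lambda> x \<in> {0..<1}"
    and "v \<ge> 0"
  shows "(SUP X\<in>mean_variance_set M m v. Lambda_version (VaR M) \<Lambda> X)
           = (SUP X\<in>mean_variance_set M m v. Lambda_version (ES M) \<Lambda> X)
       \<and> (SUP X\<in>mean_variance_set M m v. Lambda_version (ES M) \<Lambda> X)
           = (SUP X\<in>mean_variance_set M m v. Lambda_version (EVaR2 M) \<Lambda> X)
       \<and> (SUP X\<in>mean_variance_set M m v. Lambda_version (EVaR2 M) \<Lambda> X)
           = (SUP x::real. ereal (min (m + v * \<Lambda> x powr (1/2) * (1 - \<Lambda> x) powr (-1/2)) x))"
proof -
  interpret prob_space M by fact
  have \<Lambda>: "0 \<le> \<Lambda> x" "\<Lambda> x < 1" for x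
    using assms(4)[of x] by auto
  \<comment> \<open>The real powers of the claim are merged into the square root used in the
    fixed-level bounds.\<close>
  have b: "v * \<Lambda> x powr (1/2) * (1 - \<Lambda> x) powr (-1/2) = v * sqrt (\<Lambda> x / (1 - \<Lambda> x))" for x
    using \<Lambda>[of x] powr_minus_divide[of "1 - \<Lambda> x" "1/2"]
    by (simp add: powr_half_sqrt real_sqrt_divide)
  show ?thesis
    using SUP_Lambda_version[of "VaR M" \<Lambda>, OF SUP_VaR[OF assms(2,5) \<Lambda>]]
      SUP_Lambda_version[of "ES M" \<Lambda>, OF SUP_ES[OF assms(2,5) \<Lambda>]]
      SUP_Lambda_version[of "EVaR2 M" \<Lambda>, OF SUP_EVaR2[OF assms(2,5) \<Lambda>]]
    by (simp only: b)
qed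

end
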